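(* Let $q$ be a prime power and let $n, d$ be integers with $n \geq d \geq 2$. Then the metric dimension $\mu(H_q(n,d))$ of the bilinear forms graph $H_q(n,d)$ satisfies \[ \mu(H_q(n,d)) \leq \begin{cases} q^{n+d-1} & \text{if } n \geq d+2,\\ q^{n+d} & \text{otherwise}. \end{cases} \]
   Context: Bilinear forms graph: let $\mathbb{F}_q$ be the finite field with $q$ elements, let $\mathbb{F}_q^{n+d}$ be the $(n+d)$-dimensional vector space over $\mathbb{F}_q$, and let $N$ be a fixed $n$-dimensional subspace of $\mathbb{F}_q^{n+d}$. The graph $H_q(n,d)$ has as its vertex set the set of all $d$-dimensional subspaces $A$ of $\mathbb{F}_q^{n+d}$ with $A \cap N = \{0\}$; two vertices are adjacent if they intersect in a subspace of dimension $d-1$. (This is a connected graph, and the distance between two vertices $A$ and $B$ is $d - \dim(A \cap B)$.) Metric dimension: let $\Gamma$ be a connected graph with distance function $d(\cdot,\cdot)$ on vertices. For an ordered set of vertices $W = \{w_1,\ldots,w_k\}$ and a vertex $v$, put $\mathcal{D}(v|W) = (d(v,w_1),\ldots,d(v,w_k))$. The set $W$ is a resolving set of $\Gamma$ if for all vertices $u,v$ one has $\mathcal{D}(u|W) = \mathcal{D}(v|W)$ if and only if $u=v$. The metric dimension $\mu(\Gamma)$ is the smallest size of a resolving set of $\Gamma$. *)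

theory Defs
  imports "HOL-Analysis.Analysis" "Graph_Theory.Graph_Theory"
begin

text \<open>
  Undirected simple graphs are symmetric loop-free digraphs (locale \<open>graph\<close> of
  \<open>Graph_Theory\<close>).  The distance is the cost of a shortest walk, each arc costing 1.
  Its type is \<open>ereal\<close>, the value being infinite when there is no walk.
\<close>

definition graph_dist :: "('a, 'b) pre_digraph \<Rightarrow> 'a \<Rightarrow> 'a \<Rightarrow> ereal" where
  "graph_dist G u v = wf_digraph.\<mu> G (\<lambda>_. 1) u v"

definition dist_tuple :: "('a, 'b) pre_digraph \<Rightarrow> 'a list \<Rightarrow> 'a \<Rightarrow> ereal list" where
  "dist_tuple G W v = map (graph_dist G v) W"

text \<open>An ordered set of vertices is a list without repetitions.\<close>

definition resolving_set :: "('a, 'b) pre_digraph \<Rightarrow> 'a list \<Rightarrow> bool" where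
  "resolving_set G W \<longleftrightarrow> distinct W \<and> set W \<subseteq> verts G \<and>
     (\<forall>u\<in>verts G. \<forall>v\<in>verts G. dist_tuple G W u = dist_tuple G W v \<longleftrightarrow> u = v)"

text \<open>
  In a finite graph a list of all the vertices is a resolving set, so the minimum exists.
\<close>

definition metric_dimension :: "('a, 'b) pre_digraph \<Rightarrow> nat" where
  "metric_dimension G = (LEAST k. \<exists>W. resolving_set G W \<and> length W = k)"

definition bilinear_forms_vertices ::
    "nat \<Rightarrow> ('a::{field,finite} ^ 'm) set \<Rightarrow> ('a ^ 'm) set set" where
  "bilinear_forms_vertices d N =
     {A. vec.subspace A \<and> vec.dim A = d \<and> A \<inter> N = {0}}"

text \<open>
  For \<open>CARD('a) = q\<close>, \<open>CARD('m) = n + d\<close> and an \<open>n\<close>-dimensional subspace \<open>N\<close>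
  this is the graph \<open>H\<^sub>q(n,d)\<close>.  Writing \<open>dim (A \<inter> B) + 1 = d\<close> for
  \<open>dim (A \<inter> B) = d - 1\<close> avoids truncated subtraction.
\<close>

definition bilinear_forms_graph ::
    "nat \<Rightarrow> ('a::{field,finite} ^ 'm) set \<Rightarrow> ('a ^ 'm) set pair_pre_digraph" where
  "bilinear_forms_graph d N =
     \<lparr> pverts = bilinear_forms_vertices d N,
       parcs = {(A, B). A \<in> bilinear_forms_vertices d N \<and> B \<in> bilinear_forms_vertices d N \<and>
                        vec.dim (A \<inter> B) + 1 = d} \<rparr>"

lemma pair_graph_bilinear_forms_graph:
  "pair_graph (bilinear_forms_graph d N)"
proof
  let ?G = "bilinear_forms_graph d N"
  show "finite (pverts ?G)" by (rule finite)
  show "finite (parcs ?G)" by (rule finite)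
  fix e assume e: "e \<in> parcs ?G"
  obtain A B where AB: "e = (A, B)" by (cases e)
  have *: "A \<in> bilinear_forms_vertices d N" "B \<in> bilinear_forms_vertices d N"
      "vec.dim (A \<inter> B) + 1 = d"
    using e unfolding AB bilinear_forms_graph_def by simp_all
  show "fst e \<in> pverts ?G" "snd e \<in> pverts ?G"
    using * unfolding AB bilinear_forms_graph_def by simp_all
  have "vec.dim A = d" using *(1) unfolding bilinear_forms_vertices_def by blast
  then show "fst e \<noteq> snd e" using *(3) unfolding AB by force
next
  show "symmetric (with_proj (bilinear_forms_graph d N))"
    unfolding symmetric_def arcs_ends_def arc_to_ends_def
    by (intro symI) (simp add: bilinear_forms_graph_def Int_commute)
qed

end

theory Submission
  imports Defs "HOL-Algebra.Algebraic_Closure_Type"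
begin

text \<open>
  Choose a complement \<open>C\<close> of \<open>N\<close>.  The vertices are then the graphs \<open>{x + h x | x \<in> C}\<close> of the
  linear maps \<open>h\<close> from \<open>C\<close> to \<open>N\<close>; the graphs of \<open>h\<close> and \<open>k\<close> meet in a space isomorphic to
  \<open>{x \<in> C. h x = k x}\<close>, and their distance is \<open>d\<close> minus its dimension.  So the task is to find few
  maps such that the dimensions of the spaces on which \<open>h\<close> agrees with them determine \<open>h\<close>.

  Fix \<open>p \<noteq> 0\<close> in \<open>N\<close>, and let \<open>\<Psi>\<close> be a set of linear maps from \<open>C\<close> to \<open>N\<close> such that for each
  nonzero \<open>x \<in> C\<close> the values \<open>\<psi> x\<close> meet all cosets in \<open>N\<close> of the line spanned by \<open>p\<close>.  The landmarks are
  the \<open>|\<Psi>| q\<^sup>d\<close> maps \<open>\<lambda>x. \<psi> x + g x *s p\<close> with \<open>\<psi> \<in> \<Psi>\<close> and \<open>g\<close> a linear functional on \<open>C\<close>.  They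
  resolve the graph: for fixed \<open>\<psi>\<close> let \<open>S\<close> consist of the \<open>x \<in> C\<close> for which \<open>h x - \<psi> x\<close> is a
  multiple \<open>\<gamma> x *s p\<close> of \<open>p\<close>.  The map \<open>h\<close> agrees with the landmark of \<open>g\<close> exactly on the part of
  \<open>S\<close> where \<open>\<gamma> = g\<close>, and the dimensions of these parts, for all \<open>g\<close>, determine \<open>S\<close> and \<open>\<gamma>\<close> on \<open>S\<close>
  (\<open>functional_on_subspace_determined\<close>), hence \<open>h\<close> on \<open>S\<close>.  By the property of \<open>\<Psi>\<close> each
  nonzero \<open>x \<in> C\<close> lies in \<open>S\<close> for some \<open>\<psi>\<close>, so \<open>h\<close> is determined
  (\<open>metric_dimension_le_of_cover\<close>).

  A small \<open>\<Psi>\<close> comes from field multiplication.  Let \<open>M\<close> be a subspace of \<open>N\<close> that together with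
  \<open>p\<close> spans \<open>N\<close>, of dimension \<open>m \<ge> d\<close>.  Identify \<open>M\<close> with the field of \<open>q\<^sup>m\<close> elements
  and \<open>C\<close> with a subspace of that field; the multiplications by the \<open>q\<^sup>m\<close> field elements form a set
  of maps taking every nonzero \<open>x\<close> to every element of \<open>M\<close>
  (\<open>transitive_family_of_linear_maps\<close>).  This bounds the metric dimension by
  \<open>q\<^bsup>m+d\<^esup>\<close>.  A complement of \<open>p\<close> in \<open>N\<close> has \<open>m = n - 1\<close> and gives the first bound; for the second,
  take \<open>M = N\<close>.  In coding terms, \<open>\<Psi>\<close> is a maximum rank distance code in which any two maps
  differ by an injective one.
\<close>

section \<open>Subspaces and linear functionals\<close>

lemma linear_vecI:
  fixes f :: "'a::field ^ 'm \<Rightarrow> 'a ^ 'k"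
  assumes "\<And>x y. f (x + y) = f x + f y" "\<And>c x. f (c *s x) = c *s f x"
  shows "Vector_Spaces.linear (*s) (*s) f"
  unfolding Vector_Spaces.linear_iff
  using assms by (simp add: vec.vector_space_axioms)

abbreviation vec_linear :: "('a::field ^ 'm \<Rightarrow> 'a ^ 'k) \<Rightarrow> bool" where
  "vec_linear \<equiv> Vector_Spaces.linear (*s) (*s)"

abbreviation functional :: "('a::field ^ 'm \<Rightarrow> 'a) \<Rightarrow> bool" where
  "functional \<equiv> Vector_Spaces.linear (*s) (*)"

lemma functionalI:
  fixes g :: "'a::field ^ 'm \<Rightarrow> 'a"
  assumes "\<And>x y. g (x + y) = g x + g y" "\<And>c x. g (c *s x) = c * g x"
  shows "functional g"
  unfolding Vector_Spaces.linear_iff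
  using assms by (simp add: vec.vector_space_axioms vector_space_over_itself.vector_space_axioms)

lemma
  assumes "Vector_Spaces.linear (*s) s f"
  shows linear_map_add: "f (x + y) = f x + f y" and linear_map_diff: "f (x - y) = f x - f y"
    and linear_map_scale: "f (c *s x) = s c (f x)" and linear_map_zero: "f 0 = 0"
proof -
  interpret Vector_Spaces.linear "(*s)" s f by fact
  show "f (x + y) = f x + f y" "f (x - y) = f x - f y" "f (c *s x) = s c (f x)" "f 0 = 0"
    by (fact add diff scale zero)+
qed

lemmas vec_linear_simps = linear_map_add linear_map_diff linear_map_scale linear_map_zero

lemma separating_functional:
  fixes S :: "('a::field ^ 'm) set"
  assumes S: "vec.subspace S" and "s \<notin> S"
  obtains g where "functional g" "\<And>x. x \<in> S \<Longrightarrow> g x = 0" "g s = 1"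
proof -
  interpret p: vector_space_pair "(*s) :: 'a \<Rightarrow> 'a ^ 'm \<Rightarrow> 'a ^ 'm" "(*) :: 'a \<Rightarrow> 'a \<Rightarrow> 'a" ..
  obtain B where B: "B \<subseteq> S" "vec.independent B" "S \<subseteq> vec.span B"
    using vec.maximal_independent_subset by blast
  have span: "vec.span B = S" using B S by (simp add: vec.span_subspace)
  then have "vec.independent (insert s B)"
    using B(2) \<open>s \<notin> S\<close> by (simp add: vec.independent_insertI)
  then obtain g where g: "functional g" "\<And>x. x \<in> insert s B \<Longrightarrow> g x = (if x = s then 1 else 0)"
    using p.linear_independent_extend[of "insert s B" "\<lambda>x. if x = s then 1 else 0"] by blast
  have "g b = 0" if "b \<in> B" for b
    using g(2)[of b] that B(1) \<open>s \<notin> S\<close> by auto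
  then have "g x = 0" if "x \<in> S" for x
    using p.linear_eq_0_on_span[OF g(1), of B x] that span by blast
  with g show thesis by (intro that[of g]) auto
qed

lemma subspace_agreement:
  fixes f g :: "'a::field ^ 'm \<Rightarrow> 'b::ab_group_add"
  assumes "vec.subspace S" "Vector_Spaces.linear (*s) s f" "Vector_Spaces.linear (*s) s g"
  shows "vec.subspace {x \<in> S. f x = g x}"
  using assms by (auto simp: vec.subspace_def vec_linear_simps)

lemma dim_hyperplane:
  fixes S :: "('a::field ^ 'm) set"
  assumes S: "vec.subspace S" and g: "functional g" and x: "x \<in> S" "g x = 1"
  shows "vec.dim {y \<in> S. g y = 0} + 1 = vec.dim S"
proof -
  let ?H = "{y \<in> S. g y = 0}"
  have H: "vec.subspace ?H"
    using S g by (auto simp: vec.subspace_def vec_linear_simps)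
  have "y \<in> vec.span (insert x ?H)" if y: "y \<in> S" for y
  proof -
    have "y - g y *s x \<in> ?H"
      using S x y g by (simp add: vec.subspace_diff vec.subspace_scale vec_linear_simps)
    then show ?thesis
      by (meson vec.in_span_insert vec.span_base vec.span_breakdown_eq)
  qed
  moreover have "insert x ?H \<subseteq> S" using x by auto
  ultimately have "vec.span (insert x ?H) = S"
    using S by (intro vec.span_subspace) auto
  then have "vec.dim S = vec.dim (insert x ?H)"
    by (metis vec.dim_span)
  also have "\<dots> = vec.dim ?H + 1"
    using H x by (simp add: vec.dim_insert vec.span_eq_iff[THEN iffD2])
  finally show ?thesis by simp
qed

text \<open>
  A partial functional \<open>\<gamma>\<close> with domain \<open>S\<close> is determined by the dimensions of its agreement with
  the total functionals.  If the domain \<open>T\<close> of \<open>\<delta>\<close> is at least as large as \<open>S\<close>, every \<open>g\<close> extending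
  \<open>\<delta>\<close> from \<open>T\<close> agrees with \<open>\<gamma>\<close> in dimension \<open>dim T\<close>, hence on all of \<open>S\<close>.  Modifying \<open>g\<close> by a functional that
  vanishes on \<open>T\<close> then shows that \<open>S\<close> has no point outside \<open>T\<close>.
\<close>

lemma functional_on_subspace_determined:
  fixes S T :: "('a::field ^ 'm) set"
  assumes S: "vec.subspace S" and T: "vec.subspace T"
    and \<gamma>: "functional \<gamma>" and \<delta>: "functional \<delta>"
    and eq: "\<And>g. functional g \<Longrightarrow> vec.dim {x \<in> S. \<gamma> x = g x} = vec.dim {x \<in> T. \<delta> x = g x}"
  shows "S = T \<and> (\<forall>x\<in>S. \<gamma> x = \<delta> x)"
proof -
  have *: "S = T \<and> (\<forall>x\<in>S. \<gamma> x = \<delta> x)"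
    if S: "vec.subspace S" and T: "vec.subspace T"
    and \<gamma>: "functional \<gamma>" and \<delta>: "functional \<delta>"
    and eq: "\<And>g. functional g \<Longrightarrow> vec.dim {x \<in> S. \<gamma> x = g x} = vec.dim {x \<in> T. \<delta> x = g x}"
    and le: "vec.dim S \<le> vec.dim T"
    for S T :: "('a ^ 'm) set" and \<gamma> \<delta>
  proof -
    have agree: "{x \<in> S. \<gamma> x = g x} = S" if g: "functional g" "\<And>x. x \<in> T \<Longrightarrow> g x = \<delta> x" for g
    proof (rule vec.subspace_dim_equal)
      have "{x \<in> T. \<delta> x = g x} = T" using g(2) by auto
      then show "vec.dim {x \<in> S. \<gamma> x = g x} \<ge> vec.dim S"
        using eq[OF g(1)] le by simp
      show "vec.subspace {x \<in> S. \<gamma> x = g x}"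
        using S \<gamma> g(1) by (rule subspace_agreement)
    qed (use S in auto)
    have \<gamma>\<delta>: "{x \<in> S. \<gamma> x = \<delta> x} = S"
      by (rule agree[OF \<delta>]) simp
    have "S \<subseteq> T"
    proof
      fix s assume s: "s \<in> S"
      show "s \<in> T"
      proof (rule ccontr)
        assume "s \<notin> T"
        then obtain g where g: "functional g" "\<And>x. x \<in> T \<Longrightarrow> g x = 0" "g s = 1"
          using separating_functional[OF T] by blast
        have "functional (\<lambda>x. \<delta> x + g x)"
          using \<delta> g(1) by (intro functionalI) (simp_all add: vec_linear_simps algebra_simps)
        then have "{x \<in> S. \<gamma> x = \<delta> x + g x} = S"
          using g(2) by (intro agree) auto
        then show False using s \<gamma>\<delta> g(3) by force
      qed
    qed
    moreover have "vec.dim S = vec.dim T"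
      using eq[OF \<delta>] \<gamma>\<delta> by simp
    ultimately have "S = T"
      using S T by (intro vec.subspace_dim_equal) auto
    then show ?thesis using \<gamma>\<delta> by blast
  qed
  show ?thesis
  proof (cases "vec.dim S \<le> vec.dim T")
    case True
    with *[OF S T \<gamma> \<delta> eq] show ?thesis by blast
  next
    case False
    with *[OF T S \<delta> \<gamma> eq[symmetric]] show ?thesis by auto
  qed
qed

lemma card_span_independent:
  fixes scale :: "'a::{field,finite} \<Rightarrow> 'b::ab_group_add \<Rightarrow> 'b"
  assumes "vector_space scale" "finite B" "\<not> module.dependent scale B"
  shows "card (module.span scale B) = CARD('a) ^ card B"
proof -
  interpret vector_space scale by fact
  let ?f = "\<lambda>u. \<Sum>b\<in>B. scale (u b) b"
  have "?f ` (B \<rightarrow>\<^sub>E UNIV) = span B"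
  proof -
    have "?f u \<in> ?f ` (B \<rightarrow>\<^sub>E UNIV)" for u
      by (rule image_eqI[of _ _ "restrict u B"]) (auto intro!: sum.cong)
    then show ?thesis
      unfolding span_finite[OF \<open>finite B\<close>] by auto
  qed
  moreover have "inj_on ?f (B \<rightarrow>\<^sub>E UNIV)"
  proof (rule inj_onI)
    fix u v assume uv: "u \<in> B \<rightarrow>\<^sub>E UNIV" "v \<in> B \<rightarrow>\<^sub>E UNIV" "?f u = ?f v"
    have "(\<Sum>b\<in>B. scale (u b - v b) b) = 0"
      using uv(3) by (simp add: scale_left_diff_distrib sum_subtractf)
    then have "u b - v b = 0" if "b \<in> B" for b
      using independentD[of B B "\<lambda>b. u b - v b" b] assms(2,3) that by auto
    then show "u = v" using uv(1,2) by (auto intro: PiE_ext)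
  qed
  ultimately show ?thesis
    using card_image[of ?f "B \<rightarrow>\<^sub>E UNIV"] card_PiE[OF \<open>finite B\<close>, of "\<lambda>_. UNIV::'a set"]
    by (simp only: prod_constant)
qed

section \<open>The finite fields inside the algebraic closure\<close>

lemma finite_field_power_card: "(c::'a::{field,finite}) ^ CARD('a) = c"
proof (cases "c = 0")
  case False
  have "bij_betw ((*) c) (UNIV - {0}) (UNIV - {0})"
    using False by (intro bij_betwI[of _ _ _ "\<lambda>x. x / c"]) auto
  then have "(\<Prod>x\<in>UNIV - {0}. x) = (\<Prod>x\<in>UNIV - {0}. c * x)"
    by (rule prod.reindex_bij_betw[symmetric])
  also have "\<dots> = c ^ (CARD('a) - 1) * (\<Prod>x\<in>UNIV - {0}. x)"
    by (simp add: prod.distrib card_Diff_subset)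
  finally have "c ^ (CARD('a) - 1) = 1"
    by simp
  then have "c ^ Suc (CARD('a) - 1) = c"
    by (simp only: power_Suc mult_1_right)
  moreover have "Suc (CARD('a) - 1) = CARD('a)"
    by (simp add: finite_UNIV_card_ge_0)
  ultimately show ?thesis
    by (simp only:)
qed (simp add: finite_UNIV_card_ge_0)

lemma finite_field_power_card_power: "(c::'a::{field,finite}) ^ (CARD('a) ^ m) = c"
proof (induction m)
  case (Suc m)
  have "c ^ (CARD('a) ^ Suc m) = (c ^ (CARD('a) ^ m)) ^ CARD('a)"
    unfolding power_Suc2 by (rule power_mult)
  then show ?case
    by (simp only: Suc.IH finite_field_power_card)
qed simp

text \<open>
  The polynomial \<open>(X + 1)\<^sup>q - X\<^sup>q - 1\<close> has degree below \<open>q\<close> and, as \<open>c\<^sup>q = c\<close> in the field,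
  vanishes at all its \<open>q\<close> elements.  So it is zero, and its coefficients are the inner binomial
  coefficients.  This gives additivity of the Frobenius map \<open>z \<mapsto> z\<^sup>q\<close> on the algebraic closure
  without expressing \<open>q\<close> as a power of the characteristic.
\<close>

lemma of_nat_choose_card_eq_0:
  assumes "0 < k" "k < CARD('a)"
  shows "of_nat (CARD('a) choose k) = (0::'a::{field,finite})"
proof -
  let ?q = "CARD('a)"
  define P :: "'a poly" where "P = (\<Sum>i\<in>{0<..<?q}. Polynomial.monom (of_nat (?q choose i)) i)"
  have coeff: "Polynomial.coeff P i = (if i \<in> {0<..<?q} then of_nat (?q choose i) else 0)" for i
    by (simp add: P_def coeff_sum)
  have "poly P x = 0" for x
  proof -
    have "poly P x = (\<Sum>i\<in>{0<..<?q}. of_nat (?q choose i) * x ^ i)"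
      by (simp add: P_def poly_sum poly_monom)
    also have "\<dots> = (\<Sum>i\<le>?q. of_nat (?q choose i) * x ^ i) - 1 - x ^ ?q"
    proof -
      have "{..?q} = insert 0 (insert ?q {0<..<?q})" using assms by auto
      then show ?thesis using assms by simp
    qed
    also have "(\<Sum>i\<le>?q. of_nat (?q choose i) * x ^ i) = (x + 1) ^ ?q"
      by (simp add: binomial_ring)
    finally show ?thesis
      by (simp add: finite_field_power_card)
  qed
  moreover have "Polynomial.degree P < ?q"
    using assms by (intro degree_lessI) (auto simp: coeff)
  ultimately have "P = 0"
    using card_poly_roots_bound[of P] by force
  then show ?thesis
    using coeff[of k] assms by simp
qed

lemma power_card_add:
  fixes x y :: "'a::{field,finite} alg_closure"
  shows "(x + y) ^ CARD('a) = x ^ CARD('a) + y ^ CARD('a)"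
proof -
  let ?q = "CARD('a)"
  have q: "0 < ?q" by (simp add: finite_UNIV_card_ge_0)
  have 0: "of_nat (?q choose k) = (0::'a alg_closure)" if "0 < k" "k < ?q" for k
    using of_nat_choose_card_eq_0[OF that] by (metis to_ac_0 to_ac_of_nat)
  have "(x + y) ^ ?q = (\<Sum>k\<le>?q. of_nat (?q choose k) * x ^ k * y ^ (?q - k))"
    by (rule binomial_ring)
  also have "\<dots> = (\<Sum>k\<in>{0, ?q}. of_nat (?q choose k) * x ^ k * y ^ (?q - k))"
    by (intro sum.mono_neutral_right) (auto simp: 0)
  also have "\<dots> = x ^ ?q + y ^ ?q"
    using q by (subst sum.insert) auto
  finally show ?thesis .
qed

lemma power_card_power_add:
  fixes x y :: "'a::{field,finite} alg_closure"
  shows "(x + y) ^ (CARD('a) ^ m) = x ^ (CARD('a) ^ m) + y ^ (CARD('a) ^ m)"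
proof (induction m)
  case (Suc m)
  have "z ^ (CARD('a) ^ Suc m) = (z ^ (CARD('a) ^ m)) ^ CARD('a)" for z :: "'a alg_closure"
    unfolding power_Suc2 by (rule power_mult)
  then show ?case
    by (simp only: Suc.IH power_card_add)
qed simp

lemma of_nat_card_eq_0: "of_nat CARD('a) = (0::'a::{field,finite})"
proof -
  have "(\<Sum>x\<in>UNIV. x) = (\<Sum>x\<in>UNIV. x + (1::'a))"
    by (rule sum.reindex_bij_betw[symmetric]) (auto intro: bij_betwI[of _ _ _ "\<lambda>x. x - 1"])
  also have "\<dots> = (\<Sum>x\<in>UNIV. x) + of_nat CARD('a)"
    by (simp only: sum.distrib sum_constant mult_1_right)
  finally show ?thesis by (metis add_cancel_left_right)
qed

text \<open>
  The fixed points form the subfield with \<open>q\<^sup>m\<close> elements.  They are the roots of a polynomial of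
  degree \<open>q\<^sup>m\<close> that splits into linear factors and has derivative \<open>-1\<close>, so no root is repeated.
\<close>

lemma card_frobenius_fixed_points:
  assumes m: "m > 0"
  shows "card {z :: 'a::{field,finite} alg_closure. z ^ (CARD('a) ^ m) = z} = CARD('a) ^ m"
proof -
  let ?Q = "CARD('a) ^ m"
  have "2 \<le> CARD('a)"
  proof -
    have "card {0, 1::'a} \<le> CARD('a)" by (rule card_mono) auto
    then show ?thesis by simp
  qed
  then have Q: "?Q > 1" using m by (intro one_less_power) auto
  define P :: "'a alg_closure poly" where "P = Polynomial.monom 1 ?Q - Polynomial.monom 1 1"
  have "Polynomial.coeff P ?Q = 1" using Q by (simp add: P_def)
  have "Polynomial.degree P = ?Q"
    unfolding P_def diff_conv_add_uminus
    by (subst degree_add_eq_left) (use Q in \<open>auto simp: degree_monom_eq\<close>)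
  have P0: "P \<noteq> 0" using \<open>Polynomial.coeff P ?Q = 1\<close> by auto
  have "of_nat ?Q = (0::'a alg_closure)"
    using m of_nat_card_eq_0[where 'a='a] by (metis of_nat_power power_0_left to_ac_0 to_ac_of_nat neq0_conv)
  then have pd: "pderiv P = [:-1:]"
    by (simp add: P_def pderiv_diff pderiv_monom monom_0 flip: of_nat_power)
  obtain R where R: "size R = Polynomial.degree P" "P = Polynomial.smult (Polynomial.lead_coeff P) (\<Prod>x\<in>#R. [:-x, 1:])"
    using alg_closed_imp_factorization[OF P0] by blast
  have roots: "{z. z ^ ?Q = z} = set_mset R"
  proof -
    have "poly P z = 0 \<longleftrightarrow> z ^ ?Q = z" for z
      by (simp add: P_def poly_monom)
    moreover have "poly P z = 0 \<longleftrightarrow> z \<in># R" for z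
      by (subst R(2)) (use P0 in \<open>auto simp: poly_prod_mset prod_mset_zero_iff\<close>)
    ultimately show ?thesis by auto
  qed
  have "count R a \<le> 1" for a
  proof (rule ccontr)
    assume "\<not> count R a \<le> 1"
    then have "{#a, a#} \<subseteq># R"
      by (auto simp: subseteq_mset_def)
    then obtain R' where R': "R = {#a, a#} + R'"
      by (auto simp: subset_mset.le_iff_add)
    obtain S where S: "P = [:-a, 1:] * ([:-a, 1:] * S)"
      by (rule that[of "Polynomial.smult (Polynomial.lead_coeff P) (\<Prod>x\<in>#R'. [:-x, 1:])"], subst R(2)) (simp add: R')
    have "poly (pderiv P) a = 0"
      unfolding S pderiv_mult by simp
    then show False by (simp add: pd)
  qed
  then have "mset_set (set_mset R) = R"
    by (intro multiset_eqI) (metis count_mset_set(1) count_mset_set(3) count_eq_zero_iff finite_set_mset le_less_Suc_eq less_one One_nat_def le_neq_implies_less)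
  then show ?thesis
    by (metis roots R(1) \<open>Polynomial.degree P = ?Q\<close> size_mset_set)
qed

section \<open>Linear maps given by field multiplication\<close>

text \<open>
  With \<open>K\<close> the field of \<open>q\<^sup>m\<close> elements, \<open>\<alpha>\<close> an embedding of \<open>C\<close> into \<open>K\<close> and \<open>\<iota>\<close> an
  isomorphism from \<open>K\<close> onto \<open>M\<close>, the maps are \<open>\<lambda>x. \<iota> (a * \<alpha> x)\<close> for \<open>a \<in> K\<close>.  The one
  that sends \<open>x\<close> to \<open>\<iota> k\<close> belongs to \<open>a = k / \<alpha> x\<close>.
\<close>

lemma transitive_family_of_linear_maps:
  fixes C M :: "('a::{field,finite} ^ 'm) set"
  assumes C: "vec.subspace C" and M: "vec.subspace M"
    and le: "vec.dim C \<le> vec.dim M" and pos: "0 < vec.dim M"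
  obtains \<Psi> where "finite \<Psi>" "card \<Psi> \<le> CARD('a) ^ vec.dim M"
    "\<And>\<psi>. \<psi> \<in> \<Psi> \<Longrightarrow> Vector_Spaces.linear (*s) (*s) \<psi>"
    "\<And>\<psi> x. \<psi> \<in> \<Psi> \<Longrightarrow> \<psi> x \<in> M"
    "\<And>x y. x \<in> C \<Longrightarrow> x \<noteq> 0 \<Longrightarrow> y \<in> M \<Longrightarrow> \<exists>\<psi>\<in>\<Psi>. \<psi> x = y"
proof -
  let ?m = "vec.dim M"
  let ?Q = "CARD('a) ^ ?m"
  define sc :: "'a \<Rightarrow> 'a alg_closure \<Rightarrow> 'a alg_closure" where "sc = (\<lambda>c z. to_ac c * z)"
  have sc: "vector_space sc"
    by unfold_locales (simp_all add: sc_def algebra_simps)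
  interpret ac: vector_space sc by (fact sc)
  interpret va: vector_space_pair "(*s) :: 'a \<Rightarrow> 'a ^ 'm \<Rightarrow> 'a ^ 'm" sc ..
  interpret av: vector_space_pair sc "(*s) :: 'a \<Rightarrow> 'a ^ 'm \<Rightarrow> 'a ^ 'm" ..
  define K where "K = {z :: 'a alg_closure. z ^ ?Q = z}"
  have cardK: "card K = ?Q"
    unfolding K_def by (rule card_frobenius_fixed_points[OF pos])
  have Q: "?Q > 0" by (simp add: finite_UNIV_card_ge_0)
  then have finK: "finite K" using cardK by (metis card.infinite less_not_refl)
  have mult: "a * b \<in> K" if "a \<in> K" "b \<in> K" for a b
    using that by (simp add: K_def power_mult_distrib)
  have divide: "a / b \<in> K" if "a \<in> K" "b \<in> K" for a b
    using that by (simp add: K_def power_divide)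
  have K: "ac.subspace K"
  proof (rule ac.subspaceI)
    show "0 \<in> K" using Q by (simp add: K_def)
    show "x + y \<in> K" if "x \<in> K" "y \<in> K" for x y
      using that by (simp add: K_def power_card_power_add)
    have "to_ac c \<in> K" for c
      unfolding K_def mem_Collect_eq to_ac_power[symmetric] finite_field_power_card_power ..
    then show "sc c x \<in> K" if "x \<in> K" for c x
      using that by (simp add: sc_def mult)
  qed
  obtain BK where BK: "BK \<subseteq> K" "ac.independent BK" "K \<subseteq> ac.span BK"
    using ac.maximal_independent_subset by blast
  have finBK: "finite BK" using BK(1) finK by (rule finite_subset)
  have spanBK: "ac.span BK = K"
    using BK K by (simp add: ac.span_subspace)
  have "CARD('a) ^ card BK = ?Q"
    using card_span_independent[OF sc finBK BK(2)] spanBK cardK by simp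
  moreover have "1 < CARD('a)"
    using card_mono[of UNIV "{0, 1::'a}"] by simp
  ultimately have cardBK: "card BK = ?m"
    by simp
  obtain BC where BC: "BC \<subseteq> C" "vec.independent BC" "C \<subseteq> vec.span BC" "card BC = vec.dim C"
    using vec.basis_exists[of C] by blast
  have finBC: "finite BC" using BC(2) by (rule vec.finiteI_independent)
  obtain BM where BM: "BM \<subseteq> M" "vec.independent BM" "M \<subseteq> vec.span BM" "card BM = ?m"
    using vec.basis_exists[of M] by blast
  have finBM: "finite BM" using BM(2) by (rule vec.finiteI_independent)
  obtain j where j: "j ` BC \<subseteq> BK" "inj_on j BC"
    using card_le_inj[of BC BK] finBC finBK BC(4) cardBK le by auto
  obtain \<alpha> where \<alpha>: "Vector_Spaces.linear (*s) sc \<alpha>" "\<And>x. x \<in> BC \<Longrightarrow> \<alpha> x = j x"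
      "range \<alpha> = ac.span (j ` BC)"
    using va.linear_independent_extend_subspace[OF BC(2), of j] by blast
  have \<alpha>K: "\<alpha> x \<in> K" for x
    using \<alpha>(3) ac.span_mono[OF j(1)] spanBK by blast
  have \<alpha>0: "\<alpha> x \<noteq> 0" if "x \<in> C" "x \<noteq> 0" for x
  proof
    assume "\<alpha> x = 0"
    have img: "\<alpha> ` BC = j ` BC" using \<alpha>(2) by simp
    have "x = 0"
    proof (rule va.linear_indep_image_lemma[OF \<alpha>(1) finBC])
      show "ac.independent (\<alpha> ` BC)"
        unfolding img using BK(2) j(1) by (rule ac.independent_mono)
      show "inj_on \<alpha> BC" using j(2) \<alpha>(2) by (simp add: inj_on_def)
      show "x \<in> vec.span BC" using BC(3) that by blast
    qed fact
    then show False using that by simp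
  qed
  obtain f where f: "bij_betw f BK BM"
    using finite_same_card_bij[OF finBK finBM] cardBK BM(4) by auto
  obtain \<iota> where \<iota>: "Vector_Spaces.linear sc (*s) \<iota>" "\<And>z. z \<in> BK \<Longrightarrow> \<iota> z = f z"
      "range \<iota> = vec.span (f ` BK)"
    using av.linear_independent_extend_subspace[OF BK(2), of f] by blast
  have spanBM: "vec.span BM = M"
    using BM M by (simp add: vec.span_subspace)
  have fBK: "f ` BK = BM" using f by (simp add: bij_betw_def)
  have \<iota>K: "\<iota> ` K = M"
  proof -
    have "\<iota> ` ac.span BK = vec.span (\<iota> ` BK)"
      using av.linear_span_image[OF \<iota>(1)] by simp
    also have "\<iota> ` BK = BM" using \<iota>(2) fBK by simp
    finally show ?thesis using spanBK spanBM by simp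
  qed
  define \<Psi> where "\<Psi> = (\<lambda>a x. \<iota> (a * \<alpha> x)) ` K"
  interpret \<alpha>: Vector_Spaces.linear "(*s)" sc \<alpha> by (fact \<alpha>(1))
  interpret \<iota>: Vector_Spaces.linear sc "(*s)" \<iota> by (fact \<iota>(1))
  show thesis
  proof
    show "finite \<Psi>" using finK by (simp add: \<Psi>_def)
    show "card \<Psi> \<le> ?Q"
      unfolding \<Psi>_def cardK[symmetric] using finK by (rule card_image_le)
  next
    fix \<psi> assume "\<psi> \<in> \<Psi>"
    then obtain a where a: "a \<in> K" "\<psi> = (\<lambda>x. \<iota> (a * \<alpha> x))" by (auto simp: \<Psi>_def)
    show "\<psi> x \<in> M" for x
      using a \<iota>K mult[OF a(1) \<alpha>K] by blast
    show "Vector_Spaces.linear (*s) (*s) \<psi>"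
    proof (rule linear_vecI)
      show "\<psi> (x + y) = \<psi> x + \<psi> y" for x y
        by (simp add: a(2) \<alpha>.add \<iota>.add distrib_left)
      show "\<psi> (c *s x) = c *s \<psi> x" for c x
      proof -
        have "a * \<alpha> (c *s x) = sc c (a * \<alpha> x)"
          by (simp add: \<alpha>.scale sc_def mult_ac)
        then show ?thesis by (simp add: a(2) \<iota>.scale)
      qed
    qed
  next
    fix x y assume x: "x \<in> C" "x \<noteq> 0" and "y \<in> M"
    then obtain k where k: "k \<in> K" "y = \<iota> k" using \<iota>K by blast
    have "k / \<alpha> x * \<alpha> x = k" using \<alpha>0[OF x] by simp
    then show "\<exists>\<psi>\<in>\<Psi>. \<psi> x = y"
      unfolding \<Psi>_def using divide[OF k(1) \<alpha>K[of x]] k(2) by (auto intro!: bexI[of _ "k / \<alpha> x"])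
  qed
qed

section \<open>Vertices as graphs of linear maps\<close>

locale complementary_subspaces =
  fixes N C :: "('a::{field,finite} ^ 'm) set"
  assumes subspace_N: "vec.subspace N" and subspace_C: "vec.subspace C"
    and Int_0: "C \<inter> N = {0}"
    and decomposition: "\<And>v. \<exists>x\<in>C. v - x \<in> N"
begin

text \<open>
  A linear map from \<open>C\<close> to \<open>N\<close> is represented by a linear extension to the whole space, so that
  only its values on \<open>C\<close> matter; they alone enter its graph.
\<close>

definition linear_maps :: "('a ^ 'm \<Rightarrow> 'a ^ 'm) set" where
  "linear_maps = {h. vec_linear h \<and> (\<forall>x\<in>C. h x \<in> N)}"

definition graph_of :: "('a ^ 'm \<Rightarrow> 'a ^ 'm) \<Rightarrow> ('a ^ 'm) set" where
  "graph_of h = (\<lambda>x. x + h x) ` C"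

abbreviation "vertices \<equiv> bilinear_forms_vertices (vec.dim C) N"
abbreviation "G \<equiv> bilinear_forms_graph (vec.dim C) N"

lemma linear_mapsD:
  assumes "h \<in> linear_maps"
  shows "vec_linear h" "x \<in> C \<Longrightarrow> h x \<in> N"
  using assms by (simp_all add: linear_maps_def)

lemma decomposition_unique:
  assumes "x \<in> C" "y \<in> C" "v - x \<in> N" "v - y \<in> N"
  shows "x = y"
proof -
  have "x - y \<in> C"
    using subspace_C assms(1,2) by (rule vec.subspace_diff)
  moreover have "(v - y) - (v - x) \<in> N"
    using subspace_N assms(4,3) by (rule vec.subspace_diff)
  then have "x - y \<in> N"
    by simp
  ultimately have "x - y \<in> C \<inter> N"
    by (rule IntI)
  then show ?thesis
    unfolding Int_0 by simp
qed

lemma graph_point_unique: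
  assumes "h \<in> linear_maps" "k \<in> linear_maps" "x \<in> C" "y \<in> C" "x + h x = y + k y"
  shows "x = y \<and> h x = k x"
proof -
  have "x = y"
  proof (rule decomposition_unique)
    show "x + h x - x \<in> N" using assms(1,3) by (simp add: linear_mapsD)
    have "x + h x - y = k y" using assms(5) by simp
    then show "x + h x - y \<in> N" using assms(2,4) by (simp add: linear_mapsD)
  qed fact+
  with assms(5) show ?thesis by simp
qed

lemma vec_linear_graph_map:
  assumes "h \<in> linear_maps"
  shows "vec_linear (\<lambda>x. x + h x)"
  using linear_mapsD(1)[OF assms]
  by (intro linear_vecI) (simp_all add: vec_linear_simps vec.scale_right_distrib)

lemma inj_on_graph_map:
  assumes "h \<in> linear_maps"
  shows "inj_on (\<lambda>x. x + h x) C"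
  using graph_point_unique[OF assms assms] by (blast intro: inj_onI)

lemma dim_graph_image:
  assumes h: "h \<in> linear_maps" and "S \<subseteq> C"
  shows "vec.dim ((\<lambda>x. x + h x) ` S) = vec.dim S"
proof (rule vec.dim_image_eq[OF vec_linear_graph_map[OF h]])
  have "vec.span S \<subseteq> C" using \<open>S \<subseteq> C\<close> subspace_C by (rule vec.span_minimal)
  then show "inj_on (\<lambda>x. x + h x) (vec.span S)"
    using inj_on_graph_map[OF h] by (rule inj_on_subset[rotated])
qed

lemma dim_graph_Int:
  assumes h: "h \<in> linear_maps" and k: "k \<in> linear_maps"
  shows "vec.dim (graph_of h \<inter> graph_of k) = vec.dim {x \<in> C. h x = k x}"
proof -
  have "graph_of h \<inter> graph_of k = (\<lambda>x. x + h x) ` {x \<in> C. h x = k x}"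
  proof
    show "graph_of h \<inter> graph_of k \<subseteq> (\<lambda>x. x + h x) ` {x \<in> C. h x = k x}"
    proof
      fix v assume "v \<in> graph_of h \<inter> graph_of k"
      then obtain x y where xy: "x \<in> C" "y \<in> C" "v = x + h x" "v = y + k y"
        by (auto simp: graph_of_def)
      then have "x = y \<and> h x = k x"
        using graph_point_unique[OF h k xy(1,2)] by metis
      with xy show "v \<in> (\<lambda>x. x + h x) ` {x \<in> C. h x = k x}" by blast
    qed
    show "(\<lambda>x. x + h x) ` {x \<in> C. h x = k x} \<subseteq> graph_of h \<inter> graph_of k"
    proof
      fix v assume "v \<in> (\<lambda>x. x + h x) ` {x \<in> C. h x = k x}"
      then obtain x where x: "x \<in> C" "h x = k x" "v = x + h x" by blast
      then have "v = x + k x" by (simp only:)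
      with x show "v \<in> graph_of h \<inter> graph_of k"
        unfolding graph_of_def by blast
    qed
  qed
  also have "vec.dim \<dots> = vec.dim {x \<in> C. h x = k x}"
    by (rule dim_graph_image[OF h]) auto
  finally show ?thesis .
qed

lemma graph_of_in_vertices:
  assumes h: "h \<in> linear_maps"
  shows "graph_of h \<in> vertices"
proof -
  have "vec.subspace (graph_of h)"
    unfolding graph_of_def using vec_linear_graph_map[OF h] subspace_C
    by (rule vec.linear_subspace_image)
  moreover have "vec.dim (graph_of h) = vec.dim C"
    unfolding graph_of_def by (rule dim_graph_image[OF h]) simp
  moreover have "graph_of h \<inter> N = {0}"
  proof
    show "graph_of h \<inter> N \<subseteq> {0}"
    proof
      fix v assume "v \<in> graph_of h \<inter> N"
      then obtain x where x: "x \<in> C" "v = x + h x" "v \<in> N" by (auto simp: graph_of_def)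
      have "x = 0"
        by (rule decomposition_unique[of _ _ v])
          (use x h subspace_C in \<open>auto simp: linear_mapsD vec.subspace_0\<close>)
      then show "v \<in> {0}" using x(2) linear_mapsD(1)[OF h] by (simp add: vec_linear_simps)
    qed
    show "{0} \<subseteq> graph_of h \<inter> N"
      using \<open>vec.subspace (graph_of h)\<close> subspace_N by (simp add: vec.subspace_0)
  qed
  ultimately show ?thesis by (simp add: bilinear_forms_vertices_def)
qed

text \<open>
  The projection \<open>\<pi>\<close> to \<open>C\<close> along \<open>N\<close> is injective on a vertex, since its kernel is \<open>N\<close>, and by dimensions
  it maps the vertex onto \<open>C\<close>.  Its inverse has the form \<open>\<lambda>x. x + h x\<close>.
\<close>

lemma vertex_is_graph:
  assumes "A \<in> vertices"
  obtains h where "h \<in> linear_maps" "A = graph_of h"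
proof -
  have A: "vec.subspace A" "vec.dim A = vec.dim C" "A \<inter> N = {0}"
    using assms by (auto simp: bilinear_forms_vertices_def)
  obtain \<pi> where \<pi>: "\<And>v. \<pi> v \<in> C" "\<And>v. v - \<pi> v \<in> N"
    using decomposition by metis
  have lin: "vec_linear \<pi>"
  proof (rule linear_vecI)
    fix u v
    have "(u - \<pi> u) + (v - \<pi> v) \<in> N" "\<pi> u + \<pi> v \<in> C"
      by (rule vec.subspace_add subspace_N subspace_C \<pi>)+
    then show "\<pi> (u + v) = \<pi> u + \<pi> v"
      by (intro decomposition_unique[of _ _ "u + v"] \<pi>) (simp_all add: algebra_simps)
  next
    fix c v
    have "c *s (v - \<pi> v) \<in> N" "c *s \<pi> v \<in> C"
      by (rule vec.subspace_scale subspace_N subspace_C \<pi>)+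
    then show "\<pi> (c *s v) = c *s \<pi> v"
      by (intro decomposition_unique[of _ _ "c *s v"] \<pi>) (simp_all add: vec.scale_right_diff_distrib)
  qed
  have inj: "inj_on \<pi> A"
  proof (rule inj_onI)
    fix x y assume xy: "x \<in> A" "y \<in> A" "\<pi> x = \<pi> y"
    have "(x - y) - \<pi> (x - y) \<in> N" by (rule \<pi>)
    then have "x - y \<in> N" using xy(3) lin by (simp add: vec_linear_simps)
    moreover have "x - y \<in> A" using A(1) xy(1,2) by (rule vec.subspace_diff)
    ultimately have "x - y \<in> A \<inter> N" by blast
    then show "x = y" unfolding A(3) by simp
  qed
  have "\<pi> ` A = C"
  proof (rule vec.subspace_dim_equal)
    show "vec.subspace (\<pi> ` A)" using lin A(1) by (rule vec.linear_subspace_image)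
    have "vec.dim (\<pi> ` A) = vec.dim A"
      by (rule vec.dim_image_eq[OF lin]) (use inj A(1) in \<open>simp add: vec.span_eq_iff[THEN iffD2]\<close>)
    then show "vec.dim (\<pi> ` A) \<ge> vec.dim C" using A(2) by simp
  qed (use \<pi> subspace_C in auto)
  obtain f where f: "vec_linear f" "\<And>x. x \<in> A \<Longrightarrow> f (\<pi> x) = x"
    using vec.linear_exists_left_inverse_on[OF lin A(1) inj] by blast
  show thesis
  proof
    have "vec_linear (\<lambda>x. f x - x)"
      using f(1) by (intro linear_vecI) (simp_all add: vec_linear_simps vec.scale_right_diff_distrib)
    moreover have "f x - x \<in> N" if "x \<in> C" for x
    proof -
      have "x \<in> \<pi> ` A" using that \<open>\<pi> ` A = C\<close> by simp
      then obtain y where "y \<in> A" "x = \<pi> y" by blast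
      then show ?thesis using f(2) \<pi>(2)[of y] by simp
    qed
    ultimately show "(\<lambda>x. f x - x) \<in> linear_maps"
      by (simp add: linear_maps_def)
    have "graph_of (\<lambda>x. f x - x) = f ` (\<pi> ` A)"
      unfolding \<open>\<pi> ` A = C\<close> by (simp add: graph_of_def)
    also have "\<dots> = (\<lambda>y. f (\<pi> y)) ` A"
      by (rule image_image)
    also have "\<dots> = A"
      using f(2) by simp
    finally show "A = graph_of (\<lambda>x. f x - x)" ..
  qed
qed

section \<open>The distance in the bilinear forms graph\<close>

interpretation G: pair_graph G
  by (rule pair_graph_bilinear_forms_graph)

lemma pverts_G: "pverts G = vertices"
  by (simp add: bilinear_forms_graph_def)

text \<open>
  The two subspaces \<open>A \<inter> A'\<close> and \<open>A \<inter> B\<close> of \<open>A\<close>, the first of codimension one, meet in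
  codimension at most one in the second.
\<close>

lemma dim_Int_adjacent_le:
  assumes A: "vec.subspace A" "vec.dim A = d" and B: "vec.subspace B"
    and A': "vec.subspace A'" and adj: "vec.dim (A \<inter> A') + 1 = d"
  shows "vec.dim (A \<inter> B) \<le> vec.dim (A' \<inter> B) + 1"
proof -
  let ?X = "A \<inter> A'" and ?Y = "A \<inter> B"
  have XY: "vec.subspace ?X" "vec.subspace ?Y"
    using A(1) A' B by (simp_all add: vec.subspace_inter)
  have "vec.dim {x + y | x y. x \<in> ?X \<and> y \<in> ?Y} + vec.dim (?X \<inter> ?Y) = vec.dim ?X + vec.dim ?Y"
    by (rule vec.dim_sums_Int[OF XY])
  moreover have "vec.dim {x + y | x y. x \<in> ?X \<and> y \<in> ?Y} \<le> vec.dim A"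
    by (rule vec.dim_subset) (use A(1) in \<open>auto intro: vec.subspace_add\<close>)
  moreover have "vec.dim (?X \<inter> ?Y) \<le> vec.dim (A' \<inter> B)"
    by (rule vec.dim_subset) auto
  ultimately show ?thesis using A(2) adj by simp
qed

lemma awalk_length_ge:
  assumes "G.awalk A p B"
  shows "vec.dim C \<le> length p + vec.dim (A \<inter> B)"
  using assms
proof (induction p arbitrary: A)
  case Nil
  then have "A = B" "B \<in> vertices"
    by (auto simp: G.awalk_Nil_iff pverts_G)
  then show ?case
    by (simp add: bilinear_forms_vertices_def)
next
  case (Cons e p)
  obtain A' where e: "e = (A, A')" and walk: "G.awalk A' p B" and arc: "(A, A') \<in> parcs G"
    using Cons.prems by (cases e) (auto simp: G.awalk_Cons_iff)
  have "A \<in> vertices" "A' \<in> vertices" and adj: "vec.dim (A \<inter> A') + 1 = vec.dim C"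
    using arc by (auto simp: bilinear_forms_graph_def)
  moreover have "B \<in> vertices"
    using G.awalk_last_in_verts[OF walk] by (simp add: bilinear_forms_graph_def)
  ultimately have "vec.dim (A' \<inter> B) \<le> vec.dim (A \<inter> B) + 1"
    by (intro dim_Int_adjacent_le[of _ "vec.dim C"])
      (simp_all add: bilinear_forms_vertices_def Int_commute)
  with Cons.IH[OF walk] show ?case by simp
qed

text \<open>
  Correct \<open>h\<close> at a point \<open>x\<close> where it differs from \<open>k\<close> by a map of rank one that vanishes wherever
  \<open>h\<close> and \<open>k\<close> already agree.
\<close>

lemma step_towards:
  assumes h: "h \<in> linear_maps" and k: "k \<in> linear_maps"
    and lt: "vec.dim {x \<in> C. h x = k x} < vec.dim C"
  obtains h' where "h' \<in> linear_maps" "vec.dim {x \<in> C. h x = h' x} + 1 = vec.dim C"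
    "vec.dim {x \<in> C. h x = k x} < vec.dim {x \<in> C. h' x = k x}"
proof -
  let ?E = "{x \<in> C. h x = k x}"
  have E: "vec.subspace ?E"
    using subspace_C linear_mapsD(1)[OF h] linear_mapsD(1)[OF k] by (rule subspace_agreement)
  have "?E \<noteq> C" using lt by auto
  then obtain x where x: "x \<in> C" "h x \<noteq> k x" by blast
  then have "x \<notin> ?E" by simp
  then obtain g where g: "functional g" "\<And>y. y \<in> ?E \<Longrightarrow> g y = 0" "g x = 1"
    using separating_functional[OF E] by blast
  \<comment> \<open>as \<open>g x = 1\<close>, this moves the value at \<open>x\<close> from \<open>h x\<close> to \<open>k x\<close>\<close>
  define h' where "h' = (\<lambda>y. h y + g y *s (k x - h x))"
  note lin = linear_mapsD(1)[OF h] linear_mapsD(1)[OF k]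
  have lin': "vec_linear h'"
    unfolding h'_def using lin(1) g(1)
    by (intro linear_vecI) (simp_all add: vec_linear_simps vec.scale_right_distrib vec.scale_left_distrib)
  have diffN: "k x - h x \<in> N"
    using subspace_N linear_mapsD(2)[OF k x(1)] linear_mapsD(2)[OF h x(1)] by (rule vec.subspace_diff)
  have "h' y \<in> N" if "y \<in> C" for y
    unfolding h'_def
    by (intro vec.subspace_add vec.subspace_scale subspace_N diffN linear_mapsD(2)[OF h that])
  then have h': "h' \<in> linear_maps" using lin' by (simp add: linear_maps_def)
  have "{y \<in> C. h y = h' y} = {y \<in> C. g y = 0}"
    using x(2) by (auto simp: h'_def)
  then have 1: "vec.dim {y \<in> C. h y = h' y} + 1 = vec.dim C"
    using dim_hyperplane[OF subspace_C g(1) x(1) g(3)] by simp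
  have E': "vec.subspace {y \<in> C. h' y = k y}"
    using subspace_C lin' lin(2) by (rule subspace_agreement)
  have "?E \<subseteq> {y \<in> C. h' y = k y}"
    using g(2) by (auto simp: h'_def)
  moreover have "x \<in> {y \<in> C. h' y = k y}"
    using x(1) g(3) by (simp add: h'_def)
  ultimately have "?E \<subset> {y \<in> C. h' y = k y}"
    using \<open>x \<notin> ?E\<close> by blast
  then have "vec.dim ?E < vec.dim {y \<in> C. h' y = k y}"
    using E E' by (intro vec.dim_psubset) (simp add: vec.span_eq_iff[THEN iffD2])
  with h' 1 show thesis by (rule that)
qed

lemma ex_awalk:
  assumes "h \<in> linear_maps" and k: "k \<in> linear_maps"
  shows "\<exists>p. G.awalk (graph_of h) p (graph_of k) \<and>
             length p + vec.dim {x \<in> C. h x = k x} \<le> vec.dim C"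
  using assms(1)
proof (induction "vec.dim C - vec.dim {x \<in> C. h x = k x}" arbitrary: h rule: less_induct)
  case less
  show ?case
  proof (cases "vec.dim {x \<in> C. h x = k x} < vec.dim C")
    case False
    have "{x \<in> C. h x = k x} = C"
    proof (rule vec.subspace_dim_equal)
      show "vec.subspace {x \<in> C. h x = k x}"
        using subspace_C linear_mapsD(1)[OF less.prems] linear_mapsD(1)[OF k]
        by (rule subspace_agreement)
    qed (use False subspace_C in auto)
    then have "\<And>x. x \<in> C \<Longrightarrow> h x = k x" by blast
    then have "graph_of h = graph_of k" by (simp add: graph_of_def)
    then show ?thesis
      using graph_of_in_vertices[OF k] \<open>{x \<in> C. h x = k x} = C\<close>
      by (intro exI[of _ "[]"]) (simp add: G.awalk_Nil_iff pverts_G)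
  next
    case True
    obtain h' where h': "h' \<in> linear_maps" "vec.dim {x \<in> C. h x = h' x} + 1 = vec.dim C"
        "vec.dim {x \<in> C. h x = k x} < vec.dim {x \<in> C. h' x = k x}"
      using step_towards[OF less.prems k True] by blast
    obtain p where p: "G.awalk (graph_of h') p (graph_of k)"
        "length p + vec.dim {x \<in> C. h' x = k x} \<le> vec.dim C"
      using less.hyps[OF _ h'(1)] h'(3) True by fastforce
    have "(graph_of h, graph_of h') \<in> parcs G"
      using graph_of_in_vertices[OF less.prems] graph_of_in_vertices[OF h'(1)] h'(2)
        dim_graph_Int[OF less.prems h'(1)]
      by (simp add: bilinear_forms_graph_def)
    then have "G.awalk (graph_of h) ((graph_of h, graph_of h') # p) (graph_of k)"
      using p(1) by (simp add: G.awalk_Cons_iff)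
    then show ?thesis
      using p(2) h'(3) by (intro exI[of _ "(graph_of h, graph_of h') # p"]) simp
  qed
qed

lemma awalk_cost_unit: "G.awalk_cost (\<lambda>_. 1) p = length p"
  by (induction p) (simp_all)

text \<open>
  One step of a walk changes the dimension of the intersection with \<open>B\<close> by at most one, and
  as long as this dimension is not full some step raises it.
\<close>

lemma graph_dist_eq:
  assumes A: "A \<in> vertices" and B: "B \<in> vertices"
  shows "graph_dist G A B = ereal (real (vec.dim C) - real (vec.dim (A \<inter> B)))"
proof -
  obtain h k where h: "h \<in> linear_maps" "A = graph_of h" and k: "k \<in> linear_maps" "B = graph_of k"
    using vertex_is_graph[OF A] vertex_is_graph[OF B] by metis
  have dim: "vec.dim (A \<inter> B) = vec.dim {x \<in> C. h x = k x}"
    using dim_graph_Int[OF h(1) k(1)] h(2) k(2) by simp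
  obtain p where p: "G.awalk A p B" "length p + vec.dim (A \<inter> B) \<le> vec.dim C"
    using ex_awalk[OF h(1) k(1)] dim h(2) k(2) by auto
  show ?thesis
  proof (rule antisym)
    have "graph_dist G A B \<le> ereal (real (length p))"
      using G.min_cost_le_walk_cost[OF p(1), of "\<lambda>_. 1"]
      by (simp add: graph_dist_def awalk_cost_unit)
    also have "\<dots> \<le> ereal (real (vec.dim C) - real (vec.dim (A \<inter> B)))"
      using p(2) by simp
    finally show "graph_dist G A B \<le> \<dots>" .
    show "ereal (real (vec.dim C) - real (vec.dim (A \<inter> B))) \<le> graph_dist G A B"
      unfolding graph_dist_def G.\<mu>_def
    proof (rule INF_greatest)
      fix w assume "w \<in> {w. G.awalk A w B}"
      then have "vec.dim C \<le> length w + vec.dim (A \<inter> B)"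
        using awalk_length_ge by simp
      then show "ereal (real (vec.dim C) - real (vec.dim (A \<inter> B))) \<le> ereal (G.awalk_cost (\<lambda>_. 1) w)"
        by (simp add: awalk_cost_unit)
    qed
  qed
qed

lemma metric_dimension_le_card:
  assumes W: "W \<subseteq> vertices"
    and det: "\<And>A B. A \<in> vertices \<Longrightarrow> B \<in> vertices \<Longrightarrow>
      (\<And>w. w \<in> W \<Longrightarrow> vec.dim (A \<inter> w) = vec.dim (B \<inter> w)) \<Longrightarrow> A = B"
  shows "metric_dimension G \<le> card W"
proof -
  have "finite W" by (rule finite)
  then obtain ws where ws: "set ws = W" "distinct ws"
    using finite_distinct_list by blast
  have "resolving_set G ws"
    unfolding resolving_set_def
  proof (intro conjI ballI)
    show "set ws \<subseteq> verts G" using ws(1) W by (simp add: bilinear_forms_graph_def)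
    fix A B assume AB: "A \<in> verts G" "B \<in> verts G"
    then have V: "A \<in> vertices" "B \<in> vertices" by (simp_all add: bilinear_forms_graph_def)
    show "dist_tuple G ws A = dist_tuple G ws B \<longleftrightarrow> A = B"
    proof
      assume "dist_tuple G ws A = dist_tuple G ws B"
      then have eq: "graph_dist G A w = graph_dist G B w" if "w \<in> W" for w
        using that ws(1) by (auto simp: dist_tuple_def)
      show "A = B"
      proof (rule det[OF V])
        fix w assume w: "w \<in> W"
        then have "w \<in> vertices" using W by blast
        with eq[OF w] show "vec.dim (A \<inter> w) = vec.dim (B \<inter> w)"
          by (simp add: graph_dist_eq V)
      qed
    qed simp
  qed (fact ws(2))
  then have "metric_dimension G \<le> length ws"
    unfolding metric_dimension_def by (intro Least_le) blast
  then show ?thesis using ws distinct_card by fastforce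
qed

section \<open>A resolving set\<close>

text \<open>
  The landmarks for \<open>\<psi>\<close> determine \<open>h\<close> wherever \<open>h - \<psi>\<close> takes values in the line spanned by \<open>p\<close>, and the covering
  hypothesis, applied to \<open>y = h x\<close>, says that these places exhaust \<open>C\<close>.
\<close>

lemma metric_dimension_le_of_cover:
  assumes p: "p \<in> N" "p \<noteq> 0"
    and \<Psi>: "finite \<Psi>" "\<Psi> \<subseteq> linear_maps"
    and cover: "\<And>x y. x \<in> C \<Longrightarrow> x \<noteq> 0 \<Longrightarrow> y \<in> N \<Longrightarrow> \<exists>\<psi>\<in>\<Psi>. \<exists>c. y = \<psi> x + c *s p"
  shows "metric_dimension G \<le> card \<Psi> * CARD('a) ^ vec.dim C"
proof -
  interpret f: vector_space_pair "(*s) :: 'a \<Rightarrow> 'a ^ 'm \<Rightarrow> 'a ^ 'm" "(*) :: 'a \<Rightarrow> 'a \<Rightarrow> 'a" ..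
  obtain BC where BC: "BC \<subseteq> C" "vec.independent BC" "C \<subseteq> vec.span BC" "card BC = vec.dim C"
    using vec.basis_exists[of C] by blast
  have finBC: "finite BC" using BC(2) by (rule vec.finiteI_independent)
  \<comment> \<open>a functional on \<open>C\<close> is given by its values on the basis \<open>BC\<close>, which makes \<open>q\<^sup>d\<close> of them\<close>
  define I where "I = \<Psi> \<times> (BC \<rightarrow>\<^sub>E (UNIV :: 'a set))"
  define W where "W = (\<lambda>(\<psi>, u). graph_of (\<lambda>x. \<psi> x + f.construct BC u x *s p)) ` I"
  have map: "(\<lambda>x. \<psi> x + g x *s p) \<in> linear_maps" if "\<psi> \<in> \<Psi>" "functional g" for \<psi> g
  proof -
    have \<psi>: "\<psi> \<in> linear_maps" using that(1) \<Psi>(2) by blast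
    have "vec_linear (\<lambda>x. \<psi> x + g x *s p)"
      using linear_mapsD(1)[OF \<psi>] that(2)
      by (intro linear_vecI) (simp_all add: vec_linear_simps vec.scale_left_distrib vec.scale_right_distrib)
    moreover have "\<psi> x + g x *s p \<in> N" if "x \<in> C" for x
      by (intro vec.subspace_add vec.subspace_scale subspace_N p(1) linear_mapsD(2)[OF \<psi> that])
    ultimately show ?thesis by (simp add: linear_maps_def)
  qed
  have finI: "finite I" unfolding I_def using \<Psi>(1) finBC by (simp add: finite_PiE)
  have "card W \<le> card I" unfolding W_def using finI by (rule card_image_le)
  also have "card I = card \<Psi> * CARD('a) ^ vec.dim C"
    unfolding I_def card_cartesian_product BC(4)[symmetric] card_PiE[OF finBC] prod_constant ..
  finally have cardW: "card W \<le> card \<Psi> * CARD('a) ^ vec.dim C" .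
  have in_W: "graph_of (\<lambda>x. \<psi> x + g x *s p) \<in> W" if \<psi>: "\<psi> \<in> \<Psi>" and g: "functional g" for \<psi> g
  proof -
    let ?u = "restrict g BC"
    have "f.construct BC ?u x = g x" if "x \<in> C" for x
    proof (rule f.linear_eq_on[OF f.linear_construct[OF BC(2)] g])
      show "x \<in> vec.span BC" using that BC(3) by blast
      show "f.construct BC ?u b = g b" if "b \<in> BC" for b
        using f.construct_basis[OF BC(2) that, of ?u] that by simp
    qed
    then have "graph_of (\<lambda>x. \<psi> x + g x *s p) = graph_of (\<lambda>x. \<psi> x + f.construct BC ?u x *s p)"
      unfolding graph_of_def by simp
    moreover have "(\<psi>, ?u) \<in> I" using \<psi> by (simp add: I_def)
    ultimately show ?thesis unfolding W_def by force
  qed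
  have W: "W \<subseteq> vertices"
    unfolding W_def I_def
    by (auto intro!: graph_of_in_vertices map f.linear_construct[OF BC(2)])
  have "p \<notin> {0}" using p(2) by simp
  then obtain \<pi> where \<pi>: "functional \<pi>" "\<pi> p = 1"
    using separating_functional[OF vec.subspace_single_0] by blast
  have "metric_dimension G \<le> card W"
  proof (rule metric_dimension_le_card[OF W])
    fix A B assume AB: "A \<in> vertices" "B \<in> vertices"
      and same: "\<And>w. w \<in> W \<Longrightarrow> vec.dim (A \<inter> w) = vec.dim (B \<inter> w)"
    obtain h k where h: "h \<in> linear_maps" "A = graph_of h" and k: "k \<in> linear_maps" "B = graph_of k"
      using vertex_is_graph[OF AB(1)] vertex_is_graph[OF AB(2)] by metis
    have "h x = k x" if x: "x \<in> C" for x
    proof (cases "x = 0")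
      case True
      then show ?thesis using linear_mapsD(1)[OF h(1)] linear_mapsD(1)[OF k(1)]
        by (simp add: vec_linear_simps)
    next
      case False
      obtain \<psi> c where \<psi>: "\<psi> \<in> \<Psi>" and c: "h x = \<psi> x + c *s p"
        using cover[OF x False linear_mapsD(2)[OF h(1) x]] by blast
      have \<psi>_lin: "vec_linear \<psi>" using \<psi> \<Psi>(2) linear_mapsD(1) by blast
      \<comment> \<open>the coefficient of \<open>p\<close> in \<open>l y - \<psi> y\<close> whenever that is a multiple of \<open>p\<close>; through \<open>\<pi>\<close> it is linear on the whole space\<close>
      define \<gamma> where "\<gamma> = (\<lambda>l y. \<pi> (l y - \<psi> y))"
      define S where "S = (\<lambda>l. {y \<in> C. l y = \<psi> y + \<gamma> l y *s p})"
      have \<gamma>: "functional (\<gamma> l)" if "l \<in> linear_maps" for l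
        unfolding \<gamma>_def using linear_mapsD(1)[OF that] \<psi>_lin \<pi>(1)
        by (intro functionalI) (simp_all add: vec_linear_simps algebra_simps)
      have S: "vec.subspace (S l)" if "l \<in> linear_maps" for l
        unfolding S_def using subspace_C linear_mapsD(1)[OF that]
          linear_mapsD(1)[OF map[OF \<psi> \<gamma>[OF that]]] by (rule subspace_agreement)
      have agree: "{y \<in> S l. \<gamma> l y = g y} = {y \<in> C. l y = \<psi> y + g y *s p}" for l g
      proof -
        have "\<gamma> l y = g y" if "l y = \<psi> y + g y *s p" for y
          unfolding \<gamma>_def that using \<pi> by (simp add: vec_linear_simps)
        then show ?thesis by (auto simp: S_def)
      qed
      have "S h = S k \<and> (\<forall>y\<in>S h. \<gamma> h y = \<gamma> k y)"
      proof (rule functional_on_subspace_determined[OF S[OF h(1)] S[OF k(1)] \<gamma>[OF h(1)] \<gamma>[OF k(1)]])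
        fix g :: "'a ^ 'm \<Rightarrow> 'a" assume g: "functional g"
        show "vec.dim {y \<in> S h. \<gamma> h y = g y} = vec.dim {y \<in> S k. \<gamma> k y = g y}"
          using same[OF in_W[OF \<psi> g]] dim_graph_Int[OF h(1) map[OF \<psi> g]]
            dim_graph_Int[OF k(1) map[OF \<psi> g]] h(2) k(2)
          unfolding agree by simp
      qed
      moreover have "x \<in> S h"
        using agree[of h "\<lambda>_. c"] x c by blast
      ultimately have "x \<in> S k" "x \<in> S h" "\<gamma> h x = \<gamma> k x" by blast+
      then show ?thesis by (simp add: S_def)
    qed
    then show "A = B" unfolding h(2) k(2) graph_of_def by simp
  qed
  then show ?thesis using cardW by simp
qed

text \<open>
  A family that takes each nonzero \<open>x\<close> to every point of \<open>M\<close> reaches all of \<open>N\<close> modulo \<open>p\<close>.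
\<close>

lemma metric_dimension_le_power:
  assumes p: "p \<in> N" "p \<noteq> 0"
    and M: "vec.subspace M" "M \<subseteq> N" and sum_N: "\<And>y. y \<in> N \<Longrightarrow> \<exists>c. y - c *s p \<in> M"
    and le: "vec.dim C \<le> vec.dim M" and pos: "0 < vec.dim M"
  shows "metric_dimension G \<le> CARD('a) ^ (vec.dim M + vec.dim C)"
proof -
  obtain \<Psi> where \<Psi>: "finite \<Psi>" "card \<Psi> \<le> CARD('a) ^ vec.dim M"
      "\<And>\<psi>. \<psi> \<in> \<Psi> \<Longrightarrow> vec_linear \<psi>" "\<And>\<psi> x. \<psi> \<in> \<Psi> \<Longrightarrow> \<psi> x \<in> M"
      "\<And>x y. x \<in> C \<Longrightarrow> x \<noteq> 0 \<Longrightarrow> y \<in> M \<Longrightarrow> \<exists>\<psi>\<in>\<Psi>. \<psi> x = y"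
    using transitive_family_of_linear_maps[OF subspace_C M(1) le pos] by blast
  have "metric_dimension G \<le> card \<Psi> * CARD('a) ^ vec.dim C"
  proof (rule metric_dimension_le_of_cover[OF p \<Psi>(1)])
    show "\<Psi> \<subseteq> linear_maps"
      using \<Psi>(3,4) M(2) by (auto simp: linear_maps_def)
    fix x y assume x: "x \<in> C" "x \<noteq> 0" and "y \<in> N"
    then obtain c where "y - c *s p \<in> M" using sum_N by blast
    then obtain \<psi> where "\<psi> \<in> \<Psi>" "\<psi> x = y - c *s p" using \<Psi>(5)[OF x] by blast
    then have "\<psi> \<in> \<Psi>" "y = \<psi> x + c *s p" by simp_all
    then show "\<exists>\<psi>\<in>\<Psi>. \<exists>c. y = \<psi> x + c *s p" by blast
  qed
  also have "\<dots> \<le> CARD('a) ^ vec.dim M * CARD('a) ^ vec.dim C"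
    using \<Psi>(2) by (rule mult_le_mono1)
  finally show ?thesis by (simp add: power_add)
qed

end

lemma ex_complementary_subspace:
  fixes N :: "('a::{field,finite} ^ 'm) set"
  assumes N: "vec.subspace N"
  obtains C where "complementary_subspaces N C" "vec.dim C + vec.dim N = CARD('m)"
proof -
  obtain \<pi> where \<pi>: "vec_linear \<pi>" "\<And>v. \<pi> v \<in> N" "\<And>v. v \<in> N \<Longrightarrow> \<pi> v = v"
    using vec.linear_exists_left_inverse_on[OF vec.linear_id N inj_on_id] by auto
  define C where "C = {v. \<pi> v = 0}"
  have C: "vec.subspace C"
    using \<pi>(1) by (auto simp: C_def vec.subspace_def vec_linear_simps)
  have Int_0: "C \<inter> N = {0}"
    using \<pi>(3) N C by (auto simp: C_def vec.subspace_0)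
  have sum: "v - \<pi> v \<in> C" for v
    using \<pi> by (simp add: C_def vec_linear_simps)
  have "complementary_subspaces N C"
  proof
    fix v
    show "\<exists>x\<in>C. v - x \<in> N"
      using sum[of v] \<pi>(2)[of v] by (intro bexI[of _ "v - \<pi> v"]) simp_all
  qed (fact N C Int_0)+
  moreover have "{x + y | x y. x \<in> C \<and> y \<in> N} = UNIV"
  proof -
    have "v = (v - \<pi> v) + \<pi> v" for v by simp
    then show ?thesis using sum \<pi>(2) by blast
  qed
  then have "vec.dim C + vec.dim N = CARD('m)"
    using vec.dim_sums_Int[OF C N] Int_0 by (simp add: vec_dim_card del: vec.dim_UNIV)
  ultimately show thesis by (rule that)
qed

theorem theorem1p1:
  fixes q n d :: nat
    and N :: "('a::{field,finite} ^ 'm) set"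
  assumes "CARD('a) = q"
    and "n \<ge> d" and "d \<ge> 2"
    and "CARD('m) = n + d"
    and "vec.subspace N" and "vec.dim N = n"
  shows "metric_dimension (bilinear_forms_graph d N)
           \<le> (if n \<ge> d + 2 then q ^ (n + d - 1) else q ^ (n + d))"
proof -
  note N = \<open>vec.subspace N\<close> and dimN = \<open>vec.dim N = n\<close>
  obtain C where compl: "complementary_subspaces N C" and "vec.dim C + vec.dim N = CARD('m)"
    using ex_complementary_subspace[OF N] by blast
  then have dimC: "vec.dim C = d" using assms(4) dimN by simp
  interpret complementary_subspaces N C by (fact compl)
  have "\<not> N \<subseteq> {0}"
    using dimN assms(2,3) vec.dim_eq_0[of N] by linarith
  then obtain p where p: "p \<in> N" "p \<noteq> 0" by blast
  show ?thesis
  proof (cases "n \<ge> d + 2")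
    case True
    have "p \<notin> {0}" using p(2) by simp
    then obtain \<pi> where \<pi>: "functional \<pi>" "\<pi> p = 1"
      using separating_functional[OF vec.subspace_single_0] by blast
    let ?M = "{y \<in> N. \<pi> y = 0}"
    have dimM: "vec.dim ?M + 1 = n"
      using dim_hyperplane[OF N \<pi>(1) p(1) \<pi>(2)] dimN by simp
    have "metric_dimension G \<le> CARD('a) ^ (vec.dim ?M + vec.dim C)"
    proof (rule metric_dimension_le_power[OF p])
      show "vec.subspace ?M"
        using N \<pi>(1) by (auto simp: vec.subspace_def vec_linear_simps)
      show "\<exists>c. y - c *s p \<in> ?M" if "y \<in> N" for y
        using N p(1) that \<pi>
        by (intro exI[of _ "\<pi> y"]) (simp add: vec.subspace_diff vec.subspace_scale vec_linear_simps)
      show "vec.dim C \<le> vec.dim ?M" "0 < vec.dim ?M"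
        using dimM dimC True by simp_all
    qed auto
    also have "vec.dim ?M + vec.dim C = n + d - 1"
      using dimM dimC by simp
    finally show ?thesis using True assms(1) dimC by simp
  next
    case False
    have "metric_dimension G \<le> CARD('a) ^ (vec.dim N + vec.dim C)"
    proof (rule metric_dimension_le_power[OF p N])
      show "\<exists>c. y - c *s p \<in> N" if "y \<in> N" for y
        using that by (intro exI[of _ 0]) simp
    qed (use dimN dimC assms(2,3) in auto)
    then show ?thesis using False assms(1) dimC dimN by simp
  qed
qed

end
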